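(* Let $\kappa$ be an infinite cardinal with $\kappa = \kappa^{<\kappa}$ and let $x$ be a point of $S_\kappa$. If $A$ is a clopen, non-compact subset of $S_\kappa \setminus \{x\}$, then the type of $A$ in $S_\kappa$ equals $\kappa$.
   Context: A space is zero-dimensional if it has a basis of clopen sets. In a zero-dimensional space $X$, the type (in $X$) of an open subset $U$ of $X$ is the least cardinal $\tau$ such that $U$ is a union of $\tau$-many clopen subsets of $X$. An $F_\kappa$-space is a zero-dimensional space in which every open subset of type less than $\kappa$ is $C^*$-embedded (every bounded continuous real-valued function on it extends continuously to the whole space). A $\kappa$-Parovičenko space is a zero-dimensional compact Hausdorff $F_\kappa$-space of weight $\kappa^{<\kappa}$ without isolated points such that every non-empty intersection of fewer than $\kappa$-many open sets has non-empty interior. If $\kappa = \kappa^{<\kappa}$, there is, up to homeomorphism, a unique $\kappa$-Parovičenko space of weight $\kappa$; it is denoted $S_\kappa$ (equivalently, the Stone space of the unique $\kappa$-saturated Boolean algebra of size $\kappa$). "Clopen subset of $S_\kappa\setminus\{x\}$" means clopen in the subspace topology of $S_\kappa\setminus\{x\}$. *)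

theory Defs
  imports "HOL-Analysis.Analysis"
begin

unbundle cardinal_syntax

text \<open>
  Cardinals are the cardinal orders (\<^const>\<open>card_order_on\<close>) of HOL's BNF cardinal library, compared
  by \<open>=o\<close>, \<open>\<le>o\<close> and \<open><o\<close>, which relate orders over different types.
\<close>

text \<open>
  \<open>\<mu>\<close> to the power \<open>< \<kappa>\<close>: the number of functions from a proper initial segment of \<open>\<kappa>\<close> to \<open>\<mu>\<close>.
  For infinite \<open>\<kappa>\<close> and \<open>2 \<le> \<mu>\<close> this is also the supremum of the powers \<open>\<mu> ^c \<nu>\<close> with \<open>\<nu> <o \<kappa>\<close>.
\<close>
definition cexp_less :: "'a rel \<Rightarrow> 'b rel \<Rightarrow> ('b \<times> ('b \<Rightarrow> 'a)) rel"  (infixr \<open>^c<\<close> 90) where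
  "\<mu> ^c< \<kappa> = BNF_Cardinal_Arithmetic.Csum \<kappa> (\<lambda>a. \<mu> ^c |underS \<kappa> a| )"

text \<open>Meaningful only if some set satisfies \<open>P\<close>; see the lemma below.\<close>
definition least_card :: "('a set \<Rightarrow> bool) \<Rightarrow> 'a rel" where
  "least_card P = |SOME F. P F \<and> (\<forall>G. P G \<longrightarrow> |F| \<le>o |G| )|"

lemma least_card:
  assumes "P F"
  shows "\<exists>G. P G \<and> least_card P = |G|" and "least_card P \<le>o |F|"
proof -
  let ?R = "card_of ` Collect P"
  have "\<exists>r\<in>?R. \<forall>r'\<in>?R. r \<le>o r'"
    by (rule exists_minim_Card_order) (use assms card_of_Card_order in auto)
  then have "\<exists>F. P F \<and> (\<forall>G. P G \<longrightarrow> |F| \<le>o |G| )"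
    by auto
  note * = someI_ex [OF this]
  show "\<exists>G. P G \<and> least_card P = |G|" and "least_card P \<le>o |F|"
    using * assms unfolding least_card_def by blast+
qed

definition topology_basis :: "'a topology \<Rightarrow> 'a set set \<Rightarrow> bool" where
  "topology_basis X \<B> \<longleftrightarrow>
     (\<forall>V\<in>\<B>. openin X V) \<and> (\<forall>U x. openin X U \<and> x \<in> U \<longrightarrow> (\<exists>V\<in>\<B>. x \<in> V \<and> V \<subseteq> U))"

definition weight :: "'a topology \<Rightarrow> 'a set rel" where
  "weight X = least_card (topology_basis X)"

definition clopenin :: "'a topology \<Rightarrow> 'a set \<Rightarrow> bool" where
  "clopenin X C \<longleftrightarrow> openin X C \<and> closedin X C"

definition zero_dimensional :: "'a topology \<Rightarrow> bool" where
  "zero_dimensional X \<longleftrightarrow> (\<exists>\<B>. topology_basis X \<B> \<and> (\<forall>C\<in>\<B>. clopenin X C))"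

definition clopen_type :: "'a topology \<Rightarrow> 'a set \<Rightarrow> 'a set rel" where
  "clopen_type X U = least_card (\<lambda>\<C>. (\<forall>C\<in>\<C>. clopenin X C) \<and> \<Union>\<C> = U)"

definition Cstar_embedded :: "'a topology \<Rightarrow> 'a set \<Rightarrow> bool" where
  "Cstar_embedded X U \<longleftrightarrow>
     (\<forall>f :: 'a \<Rightarrow> real.
        continuous_map (subtopology X U) euclideanreal f \<and> bounded (f ` U) \<longrightarrow>
        (\<exists>g. continuous_map X euclideanreal g \<and> (\<forall>x\<in>U. g x = f x)))"

definition F_space :: "'k rel \<Rightarrow> 'a topology \<Rightarrow> bool" where
  "F_space \<kappa> X \<longleftrightarrow> zero_dimensional X \<and>
     (\<forall>U. openin X U \<and> clopen_type X U <o \<kappa> \<longrightarrow> Cstar_embedded X U)"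

text \<open>
  The intersection with \<^term>\<open>topspace X\<close> only matters for the empty family, whose intersection
  is the whole space.
\<close>
definition parovicenko_space :: "'k rel \<Rightarrow> 'a topology \<Rightarrow> bool" where
  "parovicenko_space \<kappa> X \<longleftrightarrow>
     zero_dimensional X \<and> compact_space X \<and> Hausdorff_space X \<and> F_space \<kappa> X \<and>
     weight X =o \<kappa> ^c< \<kappa> \<and>
     (\<forall>x\<in>topspace X. \<not> openin X {x}) \<and>
     (\<forall>\<U>. (\<forall>U\<in>\<U>. openin X U) \<and> |\<U>| <o \<kappa> \<and> topspace X \<inter> \<Inter>\<U> \<noteq> {} \<longrightarrow>
           X interior_of (topspace X \<inter> \<Inter>\<U>) \<noteq> {})"

text \<open>
  The space \<open>S\<^sub>\<kappa>\<close>, given up to homeomorphism: for \<open>\<kappa> =o \<kappa> ^c< \<kappa>\<close> it is the unique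
  \<open>\<kappa>\<close>-Parovicenko space of weight \<open>\<kappa>\<close>.
\<close>
definition is_S :: "'k rel \<Rightarrow> 'a topology \<Rightarrow> bool" where
  "is_S \<kappa> X \<longleftrightarrow> parovicenko_space \<kappa> X \<and> weight X =o \<kappa>"

end

theory Submission
  imports Defs
begin

text \<open>
  Suppose \<open>A\<close> is a union of \<open>\<tau> < \<kappa>\<close> clopen sets \<open>C\<^sub>i\<close>, with \<open>\<tau>\<close> minimal; as \<open>A\<close> is not compact,
  \<open>\<tau>\<close> is infinite. By minimality, fewer than \<open>\<tau>\<close> clopen subsets of \<open>A\<close> never cover \<open>A\<close>, and what they
  leave uncovered has nonempty interior. Hence one can choose by recursion on \<open>i < \<tau>\<close> nonempty clopen
  \<open>W\<^sub>i \<subseteq> A\<close> disjoint from all \<open>C\<^sub>j\<close> with \<open>j \<le> i\<close> and all \<open>W\<^sub>j\<close> with \<open>j < i\<close>. Split each \<open>W\<^sub>i\<close> into two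
  nonempty clopen pieces, with unions \<open>U\<close> and \<open>V\<close>. A closed set contained in \<open>A\<close> lies in finitely many
  \<open>C\<^sub>j\<close>, so both \<open>U\<close> and \<open>V\<close> accumulate at \<open>x\<close>, the only possible limit point of \<open>A\<close> outside \<open>A\<close>.
  But \<open>U \<union> V\<close> has type less than \<open>\<kappa>\<close>, so the indicator function of \<open>U\<close> on it extends continuously
  to \<open>x\<close>, which is impossible. The other inequality holds since the type is at most the weight.
\<close>

section \<open>Clopen sets and types of open sets\<close>

lemma zero_dimensionalE:
  assumes "zero_dimensional X" "openin X U" "p \<in> U"
  obtains C where "clopenin X C" "p \<in> C" "C \<subseteq> U"
  using assms unfolding zero_dimensional_def topology_basis_def by metis

lemma clopen_type_le:
  assumes "\<forall>C\<in>\<C>. clopenin X C" "\<Union>\<C> = U"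
  shows "clopen_type X U \<le>o |\<C>|"
  unfolding clopen_type_def
  by (rule least_card(2)[where P = "\<lambda>\<C>. (\<forall>C\<in>\<C>. clopenin X C) \<and> \<Union>\<C> = U"]) (use assms in auto)

lemma clopen_type_attained:
  assumes "zero_dimensional X" "openin X U"
  obtains \<C> where "\<forall>C\<in>\<C>. clopenin X C" "\<Union>\<C> = U" "clopen_type X U = |\<C>|"
proof -
  let ?P = "\<lambda>\<C>. (\<forall>C\<in>\<C>. clopenin X C) \<and> \<Union>\<C> = U"
  have "\<Union>{C. clopenin X C \<and> C \<subseteq> U} = U"
    using zero_dimensionalE[OF assms] by blast
  then have "?P {C. clopenin X C \<and> C \<subseteq> U}"
    by auto
  from least_card(1)[where P = ?P, OF this]
  obtain \<C> where \<C>: "?P \<C> \<and> least_card ?P = |\<C>|"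
    by (elim exE)
  show ?thesis
    using that[of \<C>] \<C>[folded clopen_type_def] by simp
qed

text \<open>A basis of minimal size need not consist of clopen sets, so each basis member that fits
  inside some clopen subset of \<open>U\<close> is replaced by one such subset. Zero-dimensionality
  makes these replacements cover \<open>U\<close>.\<close>

lemma clopen_type_le_weight:
  assumes "zero_dimensional X" "openin X U"
  shows "clopen_type X U \<le>o weight X"
proof -
  obtain \<B>\<^sub>0 where "topology_basis X \<B>\<^sub>0"
    using assms(1) unfolding zero_dimensional_def by blast
  from least_card(1)[where P = "topology_basis X", OF this]
  obtain \<B> where \<B>: "topology_basis X \<B>" "weight X = |\<B>|"
    unfolding weight_def by blast
  define \<B>' where "\<B>' = {B\<in>\<B>. \<exists>C. clopenin X C \<and> B \<subseteq> C \<and> C \<subseteq> U}"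
  have "\<forall>B\<in>\<B>'. \<exists>C. clopenin X C \<and> B \<subseteq> C \<and> C \<subseteq> U"
    unfolding \<B>'_def by blast
  then obtain c where c: "\<forall>B\<in>\<B>'. clopenin X (c B) \<and> B \<subseteq> c B \<and> c B \<subseteq> U"
    using bchoice by meson
  have "U \<subseteq> \<Union>(c ` \<B>')"
  proof
    fix p assume "p \<in> U"
    then obtain C where C: "clopenin X C" "p \<in> C" "C \<subseteq> U"
      using zero_dimensionalE[OF assms] by blast
    then obtain B where "B \<in> \<B>" "p \<in> B" "B \<subseteq> C"
      using \<B>(1) unfolding topology_basis_def clopenin_def by metis
    with C c show "p \<in> \<Union>(c ` \<B>')"
      unfolding \<B>'_def by blast
  qed
  then have "clopen_type X U \<le>o |c ` \<B>'|"
    using c by (intro clopen_type_le) blast+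
  also have "|c ` \<B>'| \<le>o |\<B>'|"
    by (rule card_of_image)
  also have "|\<B>'| \<le>o |\<B>|"
    by (rule card_of_mono1) (auto simp: \<B>'_def)
  finally show ?thesis
    using \<B>(2) by simp
qed

section \<open>Extending indicator functions\<close>

lemma continuous_map_indicator_open_Un:
  assumes "openin X U" "openin X V" "U \<inter> V = {}"
  shows "continuous_map (subtopology X (U \<union> V)) euclideanreal (indicator U)"
proof -
  \<comment> \<open>As \<open>U\<close> and \<open>V\<close> are disjoint, the preimage depends only
    on whether 1 and 0 lie in \<open>T\<close>.\<close>
  have *: "openin X {y \<in> topspace X \<inter> (U \<union> V). indicator U y \<in> T}" for T :: "real set"
  proof -
    have "{y \<in> topspace X \<inter> (U \<union> V). indicator U y \<in> T} =
        (if 1 \<in> T then U else {}) \<union> (if 0 \<in> T then V else {})"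
      using assms openin_subset[OF assms(1)] openin_subset[OF assms(2)]
      by (auto simp: indicator_def)
    then show ?thesis
      using assms by auto
  qed
  have "openin (subtopology X (U \<union> V)) {y \<in> topspace X \<inter> (U \<union> V). indicator U y \<in> T}"
    for T :: "real set"
    using * assms by (subst openin_open_subtopology) auto
  then show ?thesis
    unfolding continuous_map_def by simp
qed

text \<open>A continuous extension of the indicator function of \<open>U\<close> must be 1 on the
  closure of \<open>U\<close> and 0 on that of \<open>V\<close>.\<close>

lemma Cstar_embedded_closures_disjoint:
  assumes "Cstar_embedded X (U \<union> V)" "openin X U" "openin X V" "U \<inter> V = {}"
  shows "X closure_of U \<inter> X closure_of V = {}"
proof -
  have "bounded ((indicator U :: _ \<Rightarrow> real) ` (U \<union> V))"
    by (rule bounded_subset[of "{0, 1}"]) (auto simp: indicator_def)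
  then obtain g where g: "continuous_map X euclideanreal g" "\<forall>y\<in>U \<union> V. g y = indicator U y"
    using assms(1) continuous_map_indicator_open_Un[OF assms(2-4)]
    unfolding Cstar_embedded_def by blast
  have "g y = 1" if "y \<in> X closure_of U" for y
    by (rule forall_in_closure_of_eq[OF that, of euclideanreal g "\<lambda>_. 1"]) (use g in auto)
  moreover have "g y = 0" if "y \<in> X closure_of V" for y
    by (rule forall_in_closure_of_eq[OF that, of euclideanreal g "\<lambda>_. 0"])
      (use g assms(4) in \<open>auto simp: indicator_def\<close>)
  ultimately show ?thesis
    by fastforce
qed

text \<open>Without isolated points, \<open>W\<close> has two points; a clopen neighbourhood of one
  inside \<open>W\<close> that misses the other is a proper piece.\<close>

lemma clopen_split:
  assumes "zero_dimensional X" "Hausdorff_space X" "\<forall>p\<in>topspace X. \<not> openin X {p}"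
    and "clopenin X W" "W \<noteq> {}"
  obtains C where "clopenin X C" "C \<subseteq> W" "C \<noteq> {}" "C \<noteq> W"
proof -
  have W: "openin X W" "W \<subseteq> topspace X"
    using assms(4) openin_subset unfolding clopenin_def by blast+
  obtain p where "p \<in> W" using assms(5) by blast
  moreover obtain q where q: "q \<in> W" "q \<noteq> p"
    using W assms(3) \<open>p \<in> W\<close> by (metis (no_types, lifting) is_singletonI' is_singleton_def singletonD subsetD empty_iff)
  moreover have "openin X (W - {q})"
    using W q assms(2) by (intro openin_diff) (auto simp: closedin_Hausdorff_sing_eq)
  ultimately obtain C where "clopenin X C" "p \<in> C" "C \<subseteq> W - {q}"
    using zero_dimensionalE[OF assms(1)] by (metis Diff_iff singletonD)
  with q show ?thesis
    by (intro that) blast+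
qed

section \<open>Cardinal and order bounds\<close>

lemma card_of_Un_ordLess_Cinfinite:
  assumes "Cinfinite r" "|A| <o r" "|B| <o r"
  shows "|A \<union> B| <o r"
  using assms card_of_Un_ordLess_infinite_Field unfolding cinfinite_def by blast

lemma card_of_singleton_ordLess_Cinfinite:
  assumes "Cinfinite r"
  shows "|{a}| <o r"
  using assms by (intro finite_ordLess_infinite)
    (auto simp: cinfinite_def Field_card_of card_of_well_order_on card_order_on_well_order_on)

text \<open>Serves to replace a finite subcover by a single index above all its members.\<close>

lemma Card_order_finite_bounded:
  assumes "Card_order r" "Field r \<noteq> {}" "finite G" "G \<subseteq> Field r"
  obtains m where "m \<in> Field r" "G \<subseteq> under r m"
proof -
  have wo: "wo_rel r"
    using assms(1) by (simp add: card_order_on_well_order_on wo_rel_def)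
  have "\<exists>m\<in>Field r. G \<subseteq> under r m"
    using assms(3,4)
  proof induction
    case empty
    then show ?case using assms(2) by auto
  next
    case (insert c G)
    then obtain m where m: "m \<in> Field r" "G \<subseteq> under r m" by auto
    show ?case
    proof (cases "(c, m) \<in> r")
      case True
      with m show ?thesis by (auto simp: under_def)
    next
      case False
      then have "(m, c) \<in> r" "(c, c) \<in> r"
        using m(1) insert.prems wo_rel.TOTALS[OF wo] wo_rel.REFL[OF wo] unfolding refl_on_def by auto
      moreover have "under r m \<subseteq> under r c"
        using \<open>(m, c) \<in> r\<close> wo_rel.TRANS[OF wo] unfolding under_def trans_def by blast
      ultimately show ?thesis
        using m insert.prems by (intro bexI[of _ c]) (auto simp: under_def)
    qed
  qed
  then show ?thesis using that by blast
qed

section \<open>Disjoint clopen sets escaping a cover\<close>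

text \<open>The uncovered part is nonempty because \<open>\<G>\<close> is too small to cover
  \<open>A\<close>. It is an intersection of fewer than \<open>\<kappa>\<close> open sets, namely
  \<open>A\<close> and the complements of the members of \<open>\<G>\<close>, so it has nonempty
  interior.\<close>

lemma clopen_in_uncovered_part:
  assumes "Cinfinite \<kappa>" "parovicenko_space \<kappa> X" "openin X A"
    and "\<forall>C\<in>\<G>. clopenin X C \<and> C \<subseteq> A" "|\<G>| <o clopen_type X A" "clopen_type X A <o \<kappa>"
  shows "\<exists>W. clopenin X W \<and> W \<noteq> {} \<and> W \<subseteq> A - \<Union>\<G>"
proof -
  define \<U> where "\<U> = insert A ((\<lambda>C. topspace X - C) ` \<G>)"
  have A: "A \<subseteq> topspace X"
    using assms(3) by (rule openin_subset)
  have eq: "topspace X \<inter> \<Inter>\<U> = A - \<Union>\<G>"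
    using A unfolding \<U>_def by auto
  have "A \<noteq> \<Union>\<G>"
  proof
    assume "A = \<Union>\<G>"
    then have "clopen_type X A \<le>o |\<G>|"
      using assms(4) by (intro clopen_type_le) auto
    then show False
      using assms(5) not_ordLess_ordLeq by blast
  qed
  then have "topspace X \<inter> \<Inter>\<U> \<noteq> {}"
    using assms(4) eq by blast
  moreover have "\<forall>U\<in>\<U>. openin X U"
    using assms(3,4) unfolding \<U>_def clopenin_def by auto
  moreover have "|\<U>| <o \<kappa>"
  proof -
    have "|(\<lambda>C. topspace X - C) ` \<G>| <o \<kappa>"
      using card_of_image assms(5,6) ordLeq_ordLess_trans ordLess_transitive by blast
    then have "|{A} \<union> (\<lambda>C. topspace X - C) ` \<G>| <o \<kappa>"
      using assms(1)
      by (intro card_of_Un_ordLess_Cinfinite card_of_singleton_ordLess_Cinfinite)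
    then show ?thesis unfolding \<U>_def by simp
  qed
  ultimately have "X interior_of (A - \<Union>\<G>) \<noteq> {}"
    using assms(2) eq unfolding parovicenko_space_def by metis
  then obtain p where "p \<in> X interior_of (A - \<Union>\<G>)" by blast
  moreover have "zero_dimensional X"
    using assms(2) unfolding parovicenko_space_def by blast
  ultimately obtain W where "clopenin X W" "p \<in> W" "W \<subseteq> X interior_of (A - \<Union>\<G>)"
    using zero_dimensionalE openin_interior_of by metis
  then show ?thesis
    using interior_of_subset by fast
qed

text \<open>The cover is its own index set: \<open>card_of \<C>\<close> well-orders it so that every
  proper initial segment is smaller than \<open>\<C>\<close>, which lets well-founded recursion find
  room at each stage.\<close>

lemma disjoint_clopens_escaping_cover:
  fixes X :: "'a topology"
  assumes "Cinfinite \<kappa>" "parovicenko_space \<kappa> X" "openin X A"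
    and \<C>: "\<forall>C\<in>\<C>. clopenin X C" "\<Union>\<C> = A" "clopen_type X A = |\<C>|" "infinite \<C>"
    and "clopen_type X A <o \<kappa>"
  obtains W where "\<And>i. i \<in> \<C> \<Longrightarrow> clopenin X (W i) \<and> W i \<noteq> {} \<and> W i \<subseteq> A - \<Union>(under (card_of \<C>) i)"
    and "\<And>i j. i \<in> \<C> \<Longrightarrow> j \<in> \<C> \<Longrightarrow> i \<noteq> j \<Longrightarrow> W i \<inter> W j = {}"
proof -
  define r where "r = |\<C>|"
  have wo: "wo_rel r" and r: "Field r = \<C>" "Card_order r" "clopen_type X A = r"
    using \<C>(3) by (simp_all add: r_def wo_rel_def Field_card_of card_of_well_order_on card_of_card_order_on)
  note TOTALS = wo_rel.TOTALS[OF wo] and REFL = wo_rel.REFL[OF wo]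
  let ?R = "r - Id"
  \<comment> \<open>The recursion ranges over the whole type, so the condition is made vacuous
    outside \<open>\<C>\<close>.\<close>
  define P where "P f i w \<longleftrightarrow> (i \<in> \<C> \<longrightarrow> clopenin X w \<and> w \<noteq> {} \<and>
    w \<subseteq> A - \<Union>(under r i \<union> f ` underS r i))" for f i w
  have cinf: "Cinfinite r"
    using \<C>(4) r(1,2) by (metis cinfinite_def)
  have "\<exists>f. \<forall>i. P f i (f i)"
  proof (rule dependent_wf_choice)
    show "wf ?R" by (rule wo_rel.WF[OF wo])
  next
    fix f g :: "'a set \<Rightarrow> 'a set" and i w
    assume "\<And>j. (j, i) \<in> ?R \<Longrightarrow> f j = g j"
    then have "f ` underS r i = g ` underS r i"
      by (intro image_cong) (auto simp: underS_def)
    then show "P f i w = P g i w"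
      unfolding P_def by simp
  next
    fix f :: "'a set \<Rightarrow> 'a set" and i
    assume IH: "\<And>j. (j, i) \<in> ?R \<Longrightarrow> P f j (f j)"
    show "\<exists>w. P f i w"
    proof (cases "i \<in> \<C>")
      case True
      have less: "|underS r i| <o r"
        using True r(1,2) card_of_underS by metis
      \<comment> \<open>\<open>under\<close> includes \<open>i\<close> itself; one more element
        keeps the segment below the infinite \<open>r\<close>.\<close>
      have under: "under r i = {i} \<union> underS r i"
        using True REFL by (auto simp: under_def underS_def refl_on_def r(1))
      have sub: "underS r i \<subseteq> \<C>"
        using Order_Relation.underS_Field[of r i] by (auto simp: r(1))
      have "|under r i| <o r"
        unfolding under using cinf less
        by (intro card_of_Un_ordLess_Cinfinite card_of_singleton_ordLess_Cinfinite)
      moreover have "|f ` underS r i| <o r"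
        using card_of_image less ordLeq_ordLess_trans by blast
      ultimately have "|under r i \<union> f ` underS r i| <o clopen_type X A"
        unfolding r(3) using cinf by (intro card_of_Un_ordLess_Cinfinite)
      moreover have "clopenin X C \<and> C \<subseteq> A" if "C \<in> under r i \<union> f ` underS r i" for C
      proof -
        have "clopenin X (f j) \<and> f j \<subseteq> A" if "j \<in> underS r i" for j
          using IH[of j] that sub unfolding P_def by (auto simp: underS_def)
        moreover have "clopenin X j \<and> j \<subseteq> A" if "j \<in> under r i" for j
          using that sub True \<C>(1,2) unfolding under by blast
        ultimately show ?thesis using that by blast
      qed
      ultimately show ?thesis
        using clopen_in_uncovered_part[OF assms(1-3) _ _ assms(8)] unfolding P_def by meson
    qed (simp add: P_def)
  qed
  then obtain W where W: "\<And>i. P W i (W i)" by blast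
  \<comment> \<open>The recursion separates \<open>W i\<close> only from earlier sets; totality of
    \<open>r\<close> gives the symmetric form below.\<close>
  have lt: "W i \<inter> W j = {}" if "i \<in> \<C>" "j \<in> underS r i" for i j
    using W[of i] that unfolding P_def by blast
  show ?thesis
  proof (rule that[of W])
    show "clopenin X (W i) \<and> W i \<noteq> {} \<and> W i \<subseteq> A - \<Union>(under (card_of \<C>) i)" if "i \<in> \<C>" for i
      using W[of i] that unfolding P_def r_def by blast
    show "W i \<inter> W j = {}" if "i \<in> \<C>" "j \<in> \<C>" "i \<noteq> j" for i j
    proof -
      have "j \<in> underS r i \<or> i \<in> underS r j"
        using that TOTALS by (auto simp: underS_def r(1))
      then show ?thesis
        using lt that by blast
    qed
  qed
qed

section \<open>Accumulation at the removed point\<close>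

theorem lemma4p1:
  fixes \<kappa> :: "'k rel" and X :: "'a topology" and x :: 'a and A :: "'a set"
  assumes "Cinfinite \<kappa>"
    and "\<kappa> =o \<kappa> ^c< \<kappa>"
    and "is_S \<kappa> X"
    and "x \<in> topspace X"
    and "clopenin (subtopology X (topspace X - {x})) A"
    and "\<not> compactin X A"
  shows "clopen_type X A =o \<kappa>"
proof -
  have par: "parovicenko_space \<kappa> X" and weight: "weight X =o \<kappa>"
    using assms(3) unfolding is_S_def by auto
  then have zd: "zero_dimensional X" and comp: "compact_space X" and haus: "Hausdorff_space X"
    and F: "\<And>U. openin X U \<Longrightarrow> clopen_type X U <o \<kappa> \<Longrightarrow> Cstar_embedded X U"
    and perfect: "\<forall>p\<in>topspace X. \<not> openin X {p}"
    unfolding parovicenko_space_def F_space_def by auto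
  have "openin X (topspace X - {x})"
    using haus assms(4) by (intro openin_diff) (auto simp: closedin_Hausdorff_sing_eq)
  then have A: "openin X A"
    using assms(5) openin_open_subtopology unfolding clopenin_def by blast
  have closure_A: "X closure_of S \<subseteq> insert x A" if "S \<subseteq> A" for S
  proof -
    \<comment> \<open>Being closed away from \<open>x\<close>, \<open>A\<close> is the trace of a
      closed \<open>T\<close>, so closures within \<open>T\<close> can gain only
      \<open>x\<close>.\<close>
    obtain T where T: "closedin X T" "A = T \<inter> (topspace X - {x})"
      using assms(5) unfolding clopenin_def closedin_subtopology by blast
    then have "X closure_of S \<subseteq> T"
      using that by (intro closure_of_minimal) auto
    then show ?thesis
      using T(2) closure_of_subset_topspace[of X S] by blast
  qed
  have le: "clopen_type X A \<le>o \<kappa>"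
    using clopen_type_le_weight[OF zd A] weight ordLeq_ordIso_trans by blast
  have "\<not> clopen_type X A <o \<kappa>"
  proof
    assume small: "clopen_type X A <o \<kappa>"
    obtain \<C> where \<C>: "\<forall>C\<in>\<C>. clopenin X C" "\<Union>\<C> = A" "clopen_type X A = |\<C>|"
      using clopen_type_attained[OF zd A] by blast
    have inf: "infinite \<C>"
    proof
      assume "finite \<C>"
      then have "closedin X (\<Union>\<C>)"
        using \<C>(1) by (intro closedin_Union) (auto simp: clopenin_def)
      then show False
        using assms(6) comp \<C>(2) closedin_compact_space by blast
    qed
    obtain W where W: "\<And>i. i \<in> \<C> \<Longrightarrow> clopenin X (W i) \<and> W i \<noteq> {} \<and> W i \<subseteq> A - \<Union>(under (card_of \<C>) i)"
      and disj: "\<And>i j. i \<in> \<C> \<Longrightarrow> j \<in> \<C> \<Longrightarrow> i \<noteq> j \<Longrightarrow> W i \<inter> W j = {}"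
      using disjoint_clopens_escaping_cover[OF assms(1) par A \<C> inf small] by blast
    have "\<exists>C. clopenin X C \<and> C \<subseteq> W i \<and> C \<noteq> {} \<and> C \<noteq> W i" if "i \<in> \<C>" for i
      using clopen_split[OF zd haus perfect] W[OF that] by metis
    then obtain u where u: "\<And>i. i \<in> \<C> \<Longrightarrow> clopenin X (u i) \<and> u i \<subseteq> W i \<and> u i \<noteq> {} \<and> u i \<noteq> W i"
      by metis
    \<comment> \<open>Stated for an arbitrary selection \<open>s\<close>, since it is applied both
      to the pieces \<open>u i\<close> and to the remainders \<open>W i - u i\<close>.\<close>
    have limit: "x \<in> X closure_of (\<Union>(s ` \<C>))"
      if s: "\<And>i. i \<in> \<C> \<Longrightarrow> s i \<subseteq> W i \<and> s i \<noteq> {}" for s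
    proof (rule ccontr)
      let ?S = "\<Union>(s ` \<C>)"
      assume "x \<notin> X closure_of ?S"
      have SA: "?S \<subseteq> A"
        using s W by blast
      then have "X closure_of ?S \<subseteq> A"
        using closure_A \<open>x \<notin> _\<close> by blast
      moreover have "compactin X (X closure_of ?S)"
        using comp closedin_compact_space closedin_closure_of by blast
      ultimately have "\<exists>\<G>. finite \<G> \<and> \<G> \<subseteq> \<C> \<and> X closure_of ?S \<subseteq> \<Union>\<G>"
        using \<C>(1,2) by (intro compactinD) (auto simp: clopenin_def)
      then obtain \<G> where \<G>: "finite \<G>" "\<G> \<subseteq> \<C>" "X closure_of ?S \<subseteq> \<Union>\<G>"
        by (elim exE conjE)
      \<comment> \<open>With \<open>m\<close> above the whole subcover, \<open>W m\<close> misses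
        every member of \<open>\<G>\<close>, yet \<open>\<G>\<close> covers
        \<open>s m\<close>.\<close>
      obtain m where m: "m \<in> \<C>" "\<G> \<subseteq> under (card_of \<C>) m"
        using Card_order_finite_bounded[OF card_of_Card_order, of \<C> \<G>] \<G>(1,2) inf
        by (auto simp: Field_card_of)
      have "s m \<subseteq> X closure_of ?S"
        using closure_of_subset[of ?S X] SA A openin_subset m(1) by fast
      then have "s m \<subseteq> \<Union>(under (card_of \<C>) m)"
        using \<G>(3) m(2) by blast
      then show False
        using s[OF m(1)] W[OF m(1)] by blast
    qed
    let ?U = "\<Union>(u ` \<C>)" and ?V = "\<Union>((\<lambda>i. W i - u i) ` \<C>)"
    have UV: "?U \<union> ?V = \<Union>(W ` \<C>)"
      using u by blast
    have "openin X ?U" "openin X ?V"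
      using u W unfolding clopenin_def by (auto intro!: openin_Union openin_diff)
    moreover have "?U \<inter> ?V = {}"
    proof -
      have "u i \<inter> (W j - u j) = {}" if "i \<in> \<C>" "j \<in> \<C>" for i j
        using u[OF that(1)] disj[OF that] by (cases "i = j") blast+
      then show ?thesis by blast
    qed
    \<comment> \<open>Counting the sets \<open>W i\<close> rather than their pieces bounds the type
      by \<open>|\<C>|\<close>.\<close>
    moreover have "clopen_type X (?U \<union> ?V) <o \<kappa>"
    proof -
      have "clopen_type X (?U \<union> ?V) \<le>o |W ` \<C>|"
        using W UV by (intro clopen_type_le) auto
      also have "|W ` \<C>| \<le>o |\<C>|"
        by (rule card_of_image)
      also have "|\<C>| <o \<kappa>"
        using small \<C>(3) by simp
      finally show ?thesis .
    qed
    ultimately have "X closure_of ?U \<inter> X closure_of ?V = {}"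
      by (intro Cstar_embedded_closures_disjoint F openin_Un)
    moreover have "x \<in> X closure_of ?U"
      using u by (intro limit) blast
    moreover have "x \<in> X closure_of ?V"
      using u by (intro limit) blast
    ultimately show False by blast
  qed
  then show ?thesis
    using le ordLeq_iff_ordLess_or_ordIso by blast
qed

end
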